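(* Let $K\subset\mathbb{R}^n$ be a proper convex cone and let $f\in\mathbb{R}[x_1,\dots,x_n]$ be a strictly $K$-Lorentzian form of degree $d$ with $1\le d\le4$. Then $f$ is Hurwitz-stable over $K$.
   Context: A proper convex cone $K\subset\mathbb{R}^n$ is a nonempty convex set with $cK\subseteq K$ for all $c\ge0$ that is closed, pointed ($K\cap(-K)=\{0\}$) and has nonempty interior $\operatorname{int}K$. For $a\in\mathbb{R}^n$, $D_af=\sum_i a_i\,\partial f/\partial x_i$. A polynomial $f$ is strictly log-concave at a point $a$ if $f(a)>0$ and the Hessian of $\log f$ at $a$ is negative definite; by convention the zero polynomial is not strictly log-concave at any point. A polynomial $f$ of degree $d$ is strictly $K$-CLC (strictly $K$-completely log-concave) if for any choice of $a_1,\dots,a_m\in K$ with $m\le d$, the polynomial $D_{a_1}\cdots D_{a_m}f$ is strictly log-concave at all points of $K$. A strictly $K$-Lorentzian form is a homogeneous strictly $K$-CLC polynomial. A univariate polynomial is Hurwitz-stable if all its complex roots have negative real part. A polynomial $f$ is Hurwitz-stable over $K$ if either $f\equiv0$ or for every $x,v\in\operatorname{int}K$ the univariate polynomial $t\mapsto f(x+tv)$ is Hurwitz-stable.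
   Formalization: As worded, no form of degree d ≥ 1 is strictly K-CLC (take a = 0, the point 0, or m ≥ d−1). The formal definition takes nonzero a_i and nonzero points of K, asks strict log-concavity for m ≤ d−2 and only positivity for m = d−1, d; this is a weaker hypothesis. *)

theory Defs
  imports "HOL-Analysis.Analysis" "HOL-Computational_Algebra.Polynomial"
begin

definition proper_cone :: "(real ^ 'n) set \<Rightarrow> bool" where
  "proper_cone K \<longleftrightarrow>
     K \<noteq> {} \<and> convex K \<and> cone K \<and> closed K \<and> K \<inter> uminus ` K = {0} \<and> interior K \<noteq> {}"

text \<open>
  Polynomials in \<open>n\<close> variables over the (infinite) field of real numbers are represented by the
  functions they induce; an exponent vector is a function \<open>'n \<Rightarrow> nat\<close>.  The two index sets
  below are finite.
\<close>

definition monomial_fun :: "('n::finite \<Rightarrow> nat) \<Rightarrow> real ^ 'n \<Rightarrow> real" where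
  "monomial_fun \<alpha> x = (\<Prod>i\<in>UNIV. (x $ i) ^ \<alpha> i)"

definition polynomial_of_degree :: "nat \<Rightarrow> (real ^ 'n::finite \<Rightarrow> real) \<Rightarrow> bool" where
  "polynomial_of_degree d f \<longleftrightarrow>
     (\<exists>c. (\<forall>x. f x = (\<Sum>\<alpha> | sum \<alpha> UNIV \<le> d. c \<alpha> * monomial_fun \<alpha> x)) \<and>
          (\<exists>\<alpha>. sum \<alpha> UNIV = d \<and> c \<alpha> \<noteq> 0))"

definition homogeneous :: "nat \<Rightarrow> (real ^ 'n::finite \<Rightarrow> real) \<Rightarrow> bool" where
  "homogeneous d f \<longleftrightarrow>
     (\<exists>c. \<forall>x. f x = (\<Sum>\<alpha> | sum \<alpha> UNIV = d. c \<alpha> * monomial_fun \<alpha> x))"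

definition partial :: "'n::finite \<Rightarrow> (real ^ 'n \<Rightarrow> real) \<Rightarrow> real ^ 'n \<Rightarrow> real" where
  "partial i f x = deriv (\<lambda>t. f (x + t *\<^sub>R axis i 1)) 0"

definition dir_deriv :: "real ^ 'n::finite \<Rightarrow> (real ^ 'n \<Rightarrow> real) \<Rightarrow> real ^ 'n \<Rightarrow> real" where
  "dir_deriv a f x = (\<Sum>i\<in>UNIV. a $ i * partial i f x)"

text \<open>\<open>iter_deriv [a\<^sub>1, \<dots>, a\<^sub>m] f\<close> is \<open>D\<^bsub>a\<^sub>1\<^esub> \<dots> D\<^bsub>a\<^sub>m\<^esub> f\<close>.\<close>

definition iter_deriv ::
    "(real ^ 'n::finite) list \<Rightarrow> (real ^ 'n \<Rightarrow> real) \<Rightarrow> real ^ 'n \<Rightarrow> real" where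
  "iter_deriv as f = foldr dir_deriv as f"

definition hessian :: "(real ^ 'n::finite \<Rightarrow> real) \<Rightarrow> real ^ 'n \<Rightarrow> real ^ 'n ^ 'n" where
  "hessian g x = (\<chi> i j. partial i (partial j g) x)"

definition negative_definite :: "real ^ 'n ^ 'n::finite \<Rightarrow> bool" where
  "negative_definite A \<longleftrightarrow> (\<forall>v. v \<noteq> 0 \<longrightarrow> v \<bullet> (A *v v) < 0)"

definition strictly_log_concave_at :: "(real ^ 'n::finite \<Rightarrow> real) \<Rightarrow> real ^ 'n \<Rightarrow> bool" where
  "strictly_log_concave_at f x \<longleftrightarrow> f x > 0 \<and> negative_definite (hessian (\<lambda>y. ln (f y)) x)"

text \<open>
  The usual wording of strict complete log-concavity lets the points and the directions range over
  all of \<open>K\<close>, and the number of directions over \<open>0, \<dots>, d\<close>.  Taken literally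
  (\<open>strictly_CLC_literal\<close>) no polynomial of positive degree satisfies it: \<open>0 \<in> K\<close> is an
  admissible direction, and \<open>D\<^sub>0 f = 0\<close>.  Besides,

    \<^item> a form of positive degree vanishes at the point \<open>0\<close>;
    \<^item> a polynomial \<open>g\<close> of degree at most one, positive at \<open>x\<close>, has the log-Hessian
      \<open>- \<nabla>g (\<nabla>g)\<^sup>T / g(x)\<^sup>2\<close>, which is negative semidefinite of rank at most one and so is not
      negative definite, unless \<open>n = 1\<close> and \<open>g\<close> is not constant, when it always is.

  For forms, the only case used, \<open>strictly_CLC\<close> drops exactly these demands: points and directions are nonzero, and
  of derivatives of order \<open>d - 1\<close> and \<open>d\<close> (degree at most one) only positivity is required.
  It is implied by the literal condition.
\<close>

definition strictly_CLC_literal ::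
    "(real ^ 'n::finite) set \<Rightarrow> nat \<Rightarrow> (real ^ 'n \<Rightarrow> real) \<Rightarrow> bool" where
  "strictly_CLC_literal K d f \<longleftrightarrow>
     polynomial_of_degree d f \<and>
     (\<forall>as. length as \<le> d \<and> set as \<subseteq> K \<longrightarrow>
        (\<forall>x\<in>K. strictly_log_concave_at (iter_deriv as f) x))"

definition strictly_CLC ::
    "(real ^ 'n::finite) set \<Rightarrow> nat \<Rightarrow> (real ^ 'n \<Rightarrow> real) \<Rightarrow> bool" where
  "strictly_CLC K d f \<longleftrightarrow>
     polynomial_of_degree d f \<and>
     (\<forall>as. length as \<le> d \<and> set as \<subseteq> K - {0} \<longrightarrow>
        (\<forall>x \<in> K - {0}.
           if length as + 2 \<le> d then strictly_log_concave_at (iter_deriv as f) x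
           else iter_deriv as f x > 0))"

lemma strictly_CLC_if_literal: "strictly_CLC_literal K d f \<Longrightarrow> strictly_CLC K d f"
  unfolding strictly_CLC_def strictly_CLC_literal_def strictly_log_concave_at_def
  by (simp add: subset_iff)

lemma not_strictly_CLC_literal:
  assumes "proper_cone K" "d \<ge> 1"
  shows "\<not> strictly_CLC_literal K d f"
proof
  assume lit: "strictly_CLC_literal K d f"
  have "0 \<in> K"
    using assms(1) by (auto simp: proper_cone_def)
  then have "strictly_log_concave_at (iter_deriv [0] f) 0"
    using lit assms(2) unfolding strictly_CLC_literal_def
    by (metis One_nat_def empty_set empty_subsetI insert_subset length_Cons list.simps(15) list.size(3))
  then show False
    by (simp add: strictly_log_concave_at_def iter_deriv_def dir_deriv_def)
qed

definition strictly_Lorentzian ::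
    "(real ^ 'n::finite) set \<Rightarrow> nat \<Rightarrow> (real ^ 'n \<Rightarrow> real) \<Rightarrow> bool" where
  "strictly_Lorentzian K d f \<longleftrightarrow> homogeneous d f \<and> strictly_CLC K d f"

definition hurwitz_stable :: "real poly \<Rightarrow> bool" where
  "hurwitz_stable p \<longleftrightarrow> (\<forall>z::complex. poly (map_poly complex_of_real p) z = 0 \<longrightarrow> Re z < 0)"

text \<open>For a polynomial function \<open>f\<close> the polynomial \<open>p\<close> below exists and is unique.\<close>

definition hurwitz_stable_over ::
    "(real ^ 'n::finite) set \<Rightarrow> (real ^ 'n \<Rightarrow> real) \<Rightarrow> bool" where
  "hurwitz_stable_over K f \<longleftrightarrow>
     (\<forall>x. f x = 0) \<or>
     (\<forall>x \<in> interior K. \<forall>v \<in> interior K.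
        \<exists>p. (\<forall>t. poly p t = f (x + t *\<^sub>R v)) \<and> hurwitz_stable p)"

end

theory Submission
  imports Defs
begin

text \<open>
  Restrict \<open>f\<close> to a line: \<open>p(t) = f (x + t v)\<close> is a polynomial of degree at most \<open>d \<le> 4\<close> whose
  coefficients are \<open>b\<^sub>k = D\<^sub>v\<^sup>k f (x) / k!\<close>.  For nonzero \<open>x, v \<in> K\<close> the Lorentzian condition makes
  \<open>b\<^sub>0, \<dots>, b\<^sub>d\<close> positive.  Strict log-concavity of \<open>g = D\<^sub>v\<^sup>k f\<close> at \<open>x\<close>, tested in the direction \<open>v\<close>,
  reads \<open>g \<cdot> D\<^sub>v\<^sup>2 g < (D\<^sub>v g)\<^sup>2\<close>, so the coefficients satisfy the Newton-type inequalities
  \<open>(k + 2) b\<^sub>k b\<^bsub>k+2\<^esub> < (k + 1) b\<^bsub>k+1\<^esub>\<^sup>2\<close> (\<open>coeff_restrict_line\<close>, \<open>strictly_log_concave_along\<close>).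

  These inequalities exclude purely imaginary roots (\<open>no_imaginary_root\<close>).  For degree four,
  such a root would force the Routh-Hurwitz determinant to vanish, that is
  \<open>b\<^sub>1 b\<^sub>2 b\<^sub>3 = b\<^sub>0 b\<^sub>3\<^sup>2 + b\<^sub>1\<^sup>2 b\<^sub>4\<close>.  But multiplying neighbouring Newton inequalities gives
  \<open>3 b\<^sub>0 b\<^sub>3 \<le> b\<^sub>1 b\<^sub>2\<close> and \<open>2 b\<^sub>1 b\<^sub>4 \<le> b\<^sub>2 b\<^sub>3\<close>, which bounds the right-hand side by
  \<open>(1/3 + 1/2) b\<^sub>1 b\<^sub>2 b\<^sub>3\<close>.

  A root \<open>z\<close> of \<open>p\<close> with \<open>Re z \<ge> 0\<close> is reduced to a purely imaginary one by moving the base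
  point: \<open>i Im z\<close> is a root of \<open>t \<mapsto> f (x + Re z v + t v)\<close>, and \<open>x + Re z v\<close> is again a
  nonzero point of \<open>K\<close>.
\<close>

section \<open>Directional derivatives of polynomial functions\<close>

lemma partial_frechet:
  assumes "(f has_derivative F) (at x)"
  shows "((\<lambda>t. f (x + t *\<^sub>R axis i 1)) has_real_derivative F (axis i 1)) (at 0)"
    and "partial i f x = F (axis i 1)"
proof -
  have "((\<lambda>t. x + t *\<^sub>R axis i (1::real)) has_derivative (\<lambda>t. t *\<^sub>R axis i 1)) (at 0)"
    by (auto intro!: derivative_eq_intros)
  from has_derivative_compose[OF this, of f F] assms
  have "((\<lambda>t. f (x + t *\<^sub>R axis i 1)) has_derivative (\<lambda>t. F (t *\<^sub>R axis i 1))) (at 0)"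
    by simp
  moreover have "(\<lambda>t. F (t *\<^sub>R axis i 1)) = (*) (F (axis i 1))"
    using linear_scale[OF has_derivative_linear[OF assms]] by (auto simp: mult.commute)
  ultimately show *: "((\<lambda>t. f (x + t *\<^sub>R axis i 1)) has_real_derivative F (axis i 1)) (at 0)"
    by (simp add: has_field_derivative_def)
  show "partial i f x = F (axis i 1)"
    unfolding partial_def using * by (rule DERIV_imp_deriv)
qed

lemma dir_deriv_frechet:
  assumes "(f has_derivative F) (at x)"
  shows "dir_deriv a f x = F a"
proof -
  have "F a = F (\<Sum>i\<in>UNIV. (a $ i) *\<^sub>R axis i 1)"
    by (metis basis_expansion scalar_mult_eq_scaleR)
  also have "\<dots> = (\<Sum>i\<in>UNIV. a $ i * F (axis i 1))"
    using has_derivative_linear[OF assms] by (simp add: linear_sum linear_scale)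
  finally show ?thesis
    by (simp add: dir_deriv_def partial_frechet(2)[OF assms])
qed

lemma dir_deriv_on_line:
  assumes "f differentiable (at (x + t *\<^sub>R v))"
  shows "((\<lambda>s. f (x + s *\<^sub>R v)) has_real_derivative dir_deriv v f (x + t *\<^sub>R v)) (at t)"
proof -
  obtain F where F: "(f has_derivative F) (at (x + t *\<^sub>R v))"
    using assms by (auto simp: differentiable_def)
  have "((\<lambda>s. x + s *\<^sub>R v) has_derivative (\<lambda>s. s *\<^sub>R v)) (at t)"
    by (auto intro!: derivative_eq_intros)
  from has_derivative_compose[OF this F]
  have "((\<lambda>s. f (x + s *\<^sub>R v)) has_derivative (\<lambda>s. F (s *\<^sub>R v))) (at t)" .
  moreover have "(\<lambda>s. F (s *\<^sub>R v)) = (*) (F v)"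
    using linear_scale[OF has_derivative_linear[OF F]] by (auto simp: mult.commute)
  ultimately show ?thesis
    by (simp add: has_field_derivative_def dir_deriv_frechet[OF F])
qed

text \<open>
  The class of polynomial functions is closed under partial differentiation, so every iterated
  directional derivative is again smooth enough for the chain rule along lines.
\<close>

lemma partial_polynomial_function:
  assumes "real_polynomial_function f"
  shows "real_polynomial_function (partial i f)"
  using assms
proof induction
  case (linear f)
  then have "(f has_derivative f) (at x)" for x
    by (rule bounded_linear_imp_has_derivative)
  then have "partial i f = (\<lambda>x. f (axis i 1))"
    using partial_frechet(2) by blast
  then show ?case by auto
next
  case (const c)
  have "partial i (\<lambda>x. c) = (\<lambda>x. 0)"
    using partial_frechet(2)[OF has_derivative_const] by blast
  then show ?case by auto
next
  case (add f g)
  have "partial i (\<lambda>x. f x + g x) x = partial i f x + partial i g x" for x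
  proof -
    obtain F G where F: "(f has_derivative F) (at x)" and G: "(g has_derivative G) (at x)"
      using add.hyps differentiable_at_real_polynomial_function by (meson differentiable_def)
    show ?thesis
      by (simp add: partial_frechet(2)[OF has_derivative_add[OF F G]]
          partial_frechet(2)[OF F] partial_frechet(2)[OF G])
  qed
  then have "partial i (\<lambda>x. f x + g x) = (\<lambda>x. partial i f x + partial i g x)"
    by blast
  with add show ?case by auto
next
  case (mult f g)
  have "partial i (\<lambda>x. f x * g x) x = f x * partial i g x + partial i f x * g x" for x
  proof -
    obtain F G where F: "(f has_derivative F) (at x)" and G: "(g has_derivative G) (at x)"
      using mult.hyps differentiable_at_real_polynomial_function by (meson differentiable_def)
    show ?thesis
      by (simp add: partial_frechet(2)[OF has_derivative_mult[OF F G]]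
          partial_frechet(2)[OF F] partial_frechet(2)[OF G])
  qed
  then have "partial i (\<lambda>x. f x * g x) = (\<lambda>x. f x * partial i g x + partial i f x * g x)"
    by blast
  with mult show ?case by auto
qed

lemma dir_deriv_polynomial_function:
  assumes "real_polynomial_function f"
  shows "real_polynomial_function (dir_deriv a f)"
proof -
  have "dir_deriv a f = (\<lambda>x. \<Sum>i\<in>UNIV. a $ i * partial i f x)"
    by (simp add: dir_deriv_def fun_eq_iff)
  then show ?thesis
    by (auto intro!: real_polynomial_function_sum real_polynomial_function.intros(4)
        partial_polynomial_function assms)
qed

lemma iter_deriv_polynomial_function:
  "real_polynomial_function f \<Longrightarrow> real_polynomial_function (iter_deriv as f)"
  by (induction as) (simp_all add: iter_deriv_def dir_deriv_polynomial_function)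

section \<open>Restriction of a form to a line\<close>

lemma finite_exponents: "finite {\<alpha> :: 'n::finite \<Rightarrow> nat. sum \<alpha> UNIV = d}"
  by (rule finite_subset[OF _ finite_PiE[of UNIV "\<lambda>_. {..d}"]])
       (auto simp: member_le_sum)

lemma homogeneous_polynomial_function:
  assumes "homogeneous d f"
  shows "real_polynomial_function f"
proof -
  obtain c where "f = (\<lambda>x. \<Sum>\<alpha> | sum \<alpha> UNIV = d. c \<alpha> * monomial_fun \<alpha> x)"
    using assms by (auto simp: homogeneous_def)
  moreover have "real_polynomial_function (monomial_fun \<alpha> :: real ^ 'a \<Rightarrow> real)" for \<alpha>
    unfolding monomial_fun_def [abs_def]
    by (intro real_polynomial_function_prod real_polynomial_function_power
        real_polynomial_function.intros(1) bounded_linear_vec_nth) simp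
  ultimately show ?thesis
    by (auto intro!: real_polynomial_function_sum finite_exponents)
qed

lemma homogeneous_restrict_line:
  fixes f :: "real ^ 'n::finite \<Rightarrow> real"
  assumes "homogeneous d f"
  obtains p where "\<And>t. poly p t = f (x + t *\<^sub>R v)" "degree p \<le> d"
proof -
  obtain c where c: "\<And>x. f x = (\<Sum>\<alpha> | sum \<alpha> UNIV = d. c \<alpha> * monomial_fun \<alpha> x)"
    using assms by (auto simp: homogeneous_def)
  define m where "m \<alpha> = (\<Prod>i\<in>UNIV. [: x $ i, v $ i :] ^ \<alpha> i)" for \<alpha> :: "'n \<Rightarrow> nat"
  define p where "p = (\<Sum>\<alpha> | sum \<alpha> UNIV = d. smult (c \<alpha>) (m \<alpha>))"
  have "poly p t = f (x + t *\<^sub>R v)" for t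
    by (simp add: p_def m_def c poly_sum poly_prod monomial_fun_def)
  moreover have "degree (smult (c \<alpha>) (m \<alpha>)) \<le> d" if "sum \<alpha> UNIV = d" for \<alpha>
  proof -
    have "degree (m \<alpha>) \<le> (\<Sum>i\<in>UNIV. degree ([: x $ i, v $ i :] ^ \<alpha> i))"
      unfolding m_def using degree_prod_sum_le[of UNIV "\<lambda>i. [: x $ i, v $ i :] ^ \<alpha> i"]
      by (simp add: o_def)
    also have "\<dots> \<le> sum \<alpha> UNIV"
    proof (rule sum_mono)
      fix i
      have "degree ([: x $ i, v $ i :] ^ \<alpha> i) \<le> degree [: x $ i, v $ i :] * \<alpha> i"
        by (rule degree_power_le)
      also have "\<dots> \<le> 1 * \<alpha> i"
        by (intro mult_right_mono) auto
      finally show "degree ([: x $ i, v $ i :] ^ \<alpha> i) \<le> \<alpha> i" by simp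
    qed
    finally show ?thesis
      using that degree_smult_le order.trans by blast
  qed
  then have "degree p \<le> d"
    unfolding p_def by (intro degree_sum_le) (auto simp: finite_exponents)
  ultimately show ?thesis by (rule that)
qed

text \<open>
  This is the bridge from the Lorentzian condition, which speaks about the derivatives
  \<open>D\<^sub>v\<^sup>k f\<close> at \<open>x\<close>, to the coefficients of a univariate polynomial: both sides are the
  \<open>k\<close>-th derivative at \<open>0\<close> of \<open>t \<mapsto> f (x + t v)\<close>.
\<close>

lemma coeff_restrict_line:
  assumes f: "real_polynomial_function f"
    and p: "\<And>t. poly p t = f (x + t *\<^sub>R v)"
  shows "iter_deriv (replicate k v) f x = fact k * coeff p k"
proof -
  have "poly ((pderiv ^^ k) p) t = iter_deriv (replicate k v) f (x + t *\<^sub>R v)" for t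
  proof (induction k arbitrary: t)
    case 0
    then show ?case by (simp add: p iter_deriv_def)
  next
    case (Suc k)
    let ?g = "iter_deriv (replicate k v) f"
    have "((\<lambda>s. ?g (x + s *\<^sub>R v)) has_real_derivative dir_deriv v ?g (x + t *\<^sub>R v)) (at t)"
      by (intro dir_deriv_on_line differentiable_at_real_polynomial_function
          iter_deriv_polynomial_function f)
    moreover have "((\<lambda>s. ?g (x + s *\<^sub>R v)) has_real_derivative
        poly (pderiv ((pderiv ^^ k) p)) t) (at t)"
      using poly_DERIV[of "(pderiv ^^ k) p" t] unfolding Suc.IH .
    ultimately show ?case
      by (simp add: iter_deriv_def DERIV_unique)
  qed
  from this[of 0] show ?thesis
    by (simp add: poly_0_coeff_0 coeff_higher_pderiv pochhammer_fact)
qed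

section \<open>Log-concavity along a line\<close>

lemma partial_ln:
  fixes g :: "real ^ 'n::finite \<Rightarrow> real"
  assumes "g differentiable (at x)" "g x > 0"
  shows "partial i (\<lambda>y. ln (g y)) x = partial i g x / g x"
proof -
  obtain G where G: "(g has_derivative G) (at x)"
    using assms by (auto simp: differentiable_def)
  have "((\<lambda>t. ln (g (x + t *\<^sub>R axis i 1))) has_real_derivative
      (1 / g x) * partial i g x) (at 0)"
    using partial_frechet[OF G, of i] assms(2)
    by (auto intro!: derivative_eq_intros)
  then show ?thesis
    unfolding partial_def[of i "\<lambda>y. ln (g y)"] by (simp add: DERIV_imp_deriv)
qed

lemma hessian_ln:
  fixes g :: "real ^ 'n::finite \<Rightarrow> real"
  assumes g: "real_polynomial_function g" and pos: "g x > 0"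
  shows "hessian (\<lambda>y. ln (g y)) x $ i $ j =
    partial i (partial j g) x / g x - partial i g x * partial j g x / (g x)\<^sup>2"
proof -
  define h where "h t = x + t *\<^sub>R axis i (1::real)" for t
  have dg: "g differentiable (at y)" for y
    using g by (rule differentiable_at_real_polynomial_function)
  \<comment> \<open>The formula for the inner partial derivative needs \<open>g > 0\<close>, which continuity gives along the
    \<open>i\<close>-th coordinate line near \<open>x\<close>; that suffices for the outer derivative at \<open>x\<close>.\<close>
  have "continuous_on UNIV g"
    using g by (simp add: continuous_on_polymonial_function real_polynomial_function_eq)
  moreover have "continuous_on UNIV h"
    unfolding h_def by (intro continuous_intros)
  ultimately have "continuous_on UNIV (\<lambda>t. g (h t))"
    by (rule continuous_on_compose2) auto
  then have "open {t. 0 < g (h t)}"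
    by (intro open_Collect_less) auto
  moreover have "0 \<in> {t. 0 < g (h t)}"
    using pos by (simp add: h_def)
  ultimately have ev: "\<forall>\<^sub>F t in nhds 0. 0 < g (h t)"
    using eventually_nhds by blast
  obtain G where G: "(g has_derivative G) (at x)"
    using dg by (auto simp: differentiable_def)
  obtain P where P: "(partial j g has_derivative P) (at x)"
    using differentiable_at_real_polynomial_function[OF partial_polynomial_function[OF g]]
    unfolding differentiable_def by blast
  have "((\<lambda>t. partial j g (h t) / g (h t)) has_real_derivative
      (partial i (partial j g) x * g x - partial j g x * partial i g x) / (g x * g x)) (at 0)"
    using partial_frechet[OF G, of i] partial_frechet[OF P, of i] pos
    unfolding h_def by (auto intro!: derivative_eq_intros)
  then have "((\<lambda>t. partial j (\<lambda>y. ln (g y)) (h t)) has_real_derivative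
      (partial i (partial j g) x * g x - partial j g x * partial i g x) / (g x * g x)) (at 0)"
  proof (rule DERIV_cong_ev[THEN iffD1, OF refl _ refl, rotated])
    show "\<forall>\<^sub>F t in nhds 0. partial j g (h t) / g (h t) = partial j (\<lambda>y. ln (g y)) (h t)"
      using ev by eventually_elim (simp add: partial_ln dg)
  qed
  then have "partial i (partial j (\<lambda>y. ln (g y))) x =
      (partial i (partial j g) x * g x - partial j g x * partial i g x) / (g x * g x)"
    unfolding partial_def[of i "partial j (\<lambda>y. ln (g y))"] h_def by (rule DERIV_imp_deriv)
  then show ?thesis
    using pos by (simp add: hessian_def diff_divide_distrib power2_eq_square)
qed

lemma dir_deriv_dir_deriv:
  fixes g :: "real ^ 'n::finite \<Rightarrow> real"
  assumes g: "real_polynomial_function g"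
  shows "dir_deriv a (dir_deriv b g) x =
    (\<Sum>i\<in>UNIV. \<Sum>j\<in>UNIV. a $ i * b $ j * partial i (partial j g) x)"
proof -
  have "partial i (dir_deriv b g) x = (\<Sum>j\<in>UNIV. b $ j * partial i (partial j g) x)" for i
  proof -
    have "\<exists>P. (partial j g has_derivative P) (at x)" for j
      using differentiable_at_real_polynomial_function[OF partial_polynomial_function[OF g]]
      by (auto simp: differentiable_def)
    then obtain P where P: "\<And>j. (partial j g has_derivative P j) (at x)"
      by metis
    have "((\<lambda>y. \<Sum>j\<in>UNIV. b $ j * partial j g y) has_derivative
        (\<lambda>h. \<Sum>j\<in>UNIV. b $ j * P j h)) (at x)"
      by (intro has_derivative_sum has_derivative_mult_right P)
    from partial_frechet(2)[OF this, of i] show ?thesis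
      by (simp add: partial_frechet(2)[OF P] dir_deriv_def[abs_def])
  qed
  then show ?thesis
    by (simp add: dir_deriv_def[of a] sum_distrib_left mult.assoc)
qed

text \<open>
  The quadratic form of the Hessian of \<open>ln g\<close> at \<open>v\<close> is \<open>D\<^sub>v\<^sup>2 g / g - (D\<^sub>v g)\<^sup>2 / g\<^sup>2\<close>.
\<close>

lemma strictly_log_concave_along:
  fixes g :: "real ^ 'n::finite \<Rightarrow> real"
  assumes g: "real_polynomial_function g" and conc: "strictly_log_concave_at g x" and "v \<noteq> 0"
  shows "g x * dir_deriv v (dir_deriv v g) x < (dir_deriv v g x)\<^sup>2"
proof -
  have pos: "g x > 0" and neg: "v \<bullet> (hessian (\<lambda>y. ln (g y)) x *v v) < 0"
    using conc \<open>v \<noteq> 0\<close> by (auto simp: strictly_log_concave_at_def negative_definite_def)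
  have "v \<bullet> (hessian (\<lambda>y. ln (g y)) x *v v) =
      (\<Sum>i\<in>UNIV. \<Sum>j\<in>UNIV. v $ i * v $ j * hessian (\<lambda>y. ln (g y)) x $ i $ j)"
    by (simp add: inner_vec_def matrix_vector_mult_def sum_distrib_left mult_ac)
  also have "\<dots> = (\<Sum>i\<in>UNIV. \<Sum>j\<in>UNIV. v $ i * v $ j * partial i (partial j g) x / g x
      - (v $ i * partial i g x) * (v $ j * partial j g x) / (g x)\<^sup>2)"
    by (simp add: hessian_ln[OF g pos] algebra_simps)
  also have "\<dots> = dir_deriv v (dir_deriv v g) x / g x - (dir_deriv v g x)\<^sup>2 / (g x)\<^sup>2"
    by (simp add: dir_deriv_dir_deriv[OF g] sum_subtractf sum_divide_distrib
        dir_deriv_def[of v g] power2_eq_square sum_product)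
  finally have "dir_deriv v (dir_deriv v g) x / g x < (dir_deriv v g x)\<^sup>2 / (g x)\<^sup>2"
    using neg by simp
  then show ?thesis
    using pos by (simp add: field_simps power2_eq_square)
qed

section \<open>Newton inequalities exclude purely imaginary roots\<close>

text \<open>
  The inequalities are assumed in their weak form because then they hold for all \<open>k\<close>, also where
  coefficients beyond the degree vanish; this treats all degrees from one to four at once.
  At \<open>z = i y\<close> with \<open>Y = y\<^sup>2\<close>, the real part of the equation is \<open>a\<^sub>0 + a\<^sub>4 Y\<^sup>2 = a\<^sub>2 Y\<close>, while the
  imaginary part gives \<open>a\<^sub>1 = a\<^sub>3 Y\<close>.  The Newton inequalities yield \<open>a\<^sub>0 \<le> a\<^sub>2 Y / 3\<close> and
  \<open>a\<^sub>4 Y\<^sup>2 \<le> a\<^sub>2 Y / 2\<close>, so the real part cannot vanish.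
\<close>

lemma no_imaginary_root:
  fixes q :: "real poly"
  assumes deg: "degree q \<le> 4"
    and nonneg: "\<And>k. coeff q k \<ge> 0"
    and pos: "coeff q 0 > 0" "coeff q 1 > 0"
    and newton: "\<And>k. real (k + 2) * (coeff q k * coeff q (k + 2)) \<le> real (k + 1) * (coeff q (k + 1))\<^sup>2"
    and "Re z = 0"
  shows "poly (map_poly complex_of_real q) z \<noteq> 0"
proof
  assume root: "poly (map_poly complex_of_real q) z = 0"
  define a where "a = coeff q"
  define y where "y = Im z"
  define Y where "Y = y\<^sup>2"
  have z: "z = \<i> * of_real y"
    using \<open>Re z = 0\<close> by (simp add: y_def complex_eq_iff)
  have "poly (map_poly complex_of_real q) z = (\<Sum>k\<le>degree q. of_real (a k) * z ^ k)"
    by (simp add: poly_altdef coeff_map_poly a_def degree_map_poly)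
  also have "\<dots> = (\<Sum>k\<le>4. of_real (a k) * z ^ k)"
    using deg by (intro sum.mono_neutral_left) (auto simp: a_def coeff_eq_0)
  also have "\<dots> = of_real (a 0 - a 2 * Y + a 4 * Y\<^sup>2) + \<i> * of_real (y * (a 1 - a 3 * Y))"
    by (simp add: z Y_def eval_nat_numeral algebra_simps)
  finally have "complex_of_real (a 0 - a 2 * Y + a 4 * Y\<^sup>2) + \<i> * of_real (y * (a 1 - a 3 * Y)) = 0"
    using root by simp
  then have re: "a 0 + a 4 * Y\<^sup>2 = a 2 * Y" and im: "y = 0 \<or> a 1 = a 3 * Y"
    by (auto simp: complex_eq_iff)
  have a: "a 0 > 0" "a 1 > 0" "a 2 \<ge> 0" "a 3 \<ge> 0" "a 4 \<ge> 0"
    using pos nonneg by (auto simp: a_def)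
  have n0: "2 * (a 0 * a 2) \<le> (a 1)\<^sup>2" and n1: "3 * (a 1 * a 3) \<le> 2 * (a 2)\<^sup>2"
    and n2: "4 * (a 2 * a 4) \<le> 3 * (a 3)\<^sup>2"
    using newton[of 0] newton[of 1] newton[of 2] by (simp_all add: a_def eval_nat_numeral)
  have "y \<noteq> 0"
    using re a by (auto simp: Y_def)
  then have "Y > 0" and a1: "a 1 = a 3 * Y"
    using im by (auto simp: Y_def)
  \<comment> \<open>In degrees below three a contradiction already occurs here: \<open>a 3 = 0\<close> makes \<open>a 1\<close> vanish.\<close>
  with a have "a 3 > 0"
    by (metis less_eq_real_def mult_zero_left)
  then have "a 2 > 0"
    using n1 a mult_pos_pos[OF \<open>a 1 > 0\<close> \<open>a 3 > 0\<close>]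
    by (metis less_eq_real_def linorder_not_le mult_pos_pos mult_zero_right
        zero_less_numeral zero_power2)
  \<comment> \<open>Multiply the inequalities for \<open>k = 0, 1\<close> and cancel \<open>2 a\<^sub>1 a\<^sub>2\<close>; then do the same for
    \<open>k = 1, 2\<close>, cancelling \<open>6 a\<^sub>2 a\<^sub>3\<close>.\<close>
  have "a 2 * (3 * (a 0 * a 3)) * (a 1 * 2) \<le> a 2 * (a 1 * a 2) * (a 1 * 2)"
  proof -
    have "(2 * (a 0 * a 2)) * (3 * (a 1 * a 3)) \<le> (a 1)\<^sup>2 * (2 * (a 2)\<^sup>2)"
      by (rule mult_mono[OF n0 n1]) (use a in auto)
    then show ?thesis by (simp add: power2_eq_square mult_ac)
  qed
  then have 1: "3 * (a 0 * a 3) \<le> a 1 * a 2"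
    using \<open>a 2 > 0\<close> \<open>a 1 > 0\<close> by simp
  have "a 2 * (2 * (a 1 * a 4)) * (a 3 * 6) \<le> a 2 * (a 2 * a 3) * (a 3 * 6)"
  proof -
    have "(3 * (a 1 * a 3)) * (4 * (a 2 * a 4)) \<le> (2 * (a 2)\<^sup>2) * (3 * (a 3)\<^sup>2)"
      by (rule mult_mono[OF n1 n2]) (use a in auto)
    then show ?thesis by (simp add: power2_eq_square mult_ac)
  qed
  then have 2: "2 * (a 1 * a 4) \<le> a 2 * a 3"
    using \<open>a 2 > 0\<close> \<open>a 3 > 0\<close> by simp
  have "a 3 * (3 * a 0) \<le> a 3 * (Y * a 2)"
    using 1 unfolding a1 by (simp only: mult_ac)
  then have "3 * a 0 \<le> Y * a 2"
    using \<open>a 3 > 0\<close> by simp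
  moreover have "a 3 * (2 * (Y * a 4)) \<le> a 3 * a 2"
    using 2 unfolding a1 by (simp only: mult_ac)
  then have "2 * (Y * a 4) \<le> a 2"
    using \<open>a 3 > 0\<close> by simp
  then have "Y * (2 * (Y * a 4)) \<le> Y * a 2"
    using \<open>Y > 0\<close> by simp
  moreover have "0 < Y * a 2"
    using \<open>Y > 0\<close> \<open>a 2 > 0\<close> by simp
  ultimately show False
    using re by (simp add: power2_eq_square mult_ac)
qed

section \<open>Hurwitz stability\<close>

lemma poly_of_real_shift:
  "poly (map_poly complex_of_real (p \<circ>\<^sub>p [:r, 1:])) s = poly (map_poly complex_of_real p) (of_real r + s)"
proof (induction p)
  case 0
  then show ?case by simp
next
  case (pCons a p)
  have add: "map_poly complex_of_real (A + B) = map_poly of_real A + map_poly of_real B" for A B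
    by (rule poly_eqI) (simp add: coeff_map_poly)
  have smult: "map_poly complex_of_real (smult c A) = smult (of_real c) (map_poly of_real A)" for c A
    by (rule poly_eqI) (simp add: coeff_map_poly)
  show ?case
    by (simp add: pcompose_pCons add smult map_poly_pCons pCons.IH algebra_simps)
qed

theorem theorem4p19:
  fixes K :: "(real ^ 'n::finite) set" and f :: "real ^ 'n \<Rightarrow> real" and d :: nat
  assumes "proper_cone K"
    and "strictly_Lorentzian K d f"
    and "1 \<le> d" and "d \<le> 4"
  shows "hurwitz_stable_over K f"
proof -
  have cone: "convex K" "cone K" "K \<inter> uminus ` K = {0}"
    using assms(1) by (auto simp: proper_cone_def)
  have hom: "homogeneous d f" and clc: "strictly_CLC K d f"
    using assms(2) by (auto simp: strictly_Lorentzian_def)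
  have poly: "real_polynomial_function f"
    using hom by (rule homogeneous_polynomial_function)
  have "0 \<notin> interior K"
  proof
    assume "0 \<in> interior K"
    then obtain e where e: "e > 0" "cball 0 e \<subseteq> K"
      using mem_interior_cball by blast
    obtain i :: 'n where True by simp
    have "e *\<^sub>R axis i 1 \<in> K" "- (e *\<^sub>R axis i 1) \<in> K"
      using e by (auto intro!: subsetD[OF e(2)] simp: norm_axis_1)
    then have "e *\<^sub>R axis i (1::real) \<in> K \<inter> uminus ` K"
      by (metis IntI add.inverse_inverse imageI)
    then show False
      using cone(3) e by (simp add: axis_eq_0_iff)
  qed
  then have int: "x \<in> K - {0}" if "x \<in> interior K" for x
    using that interior_subset by blast
  \<comment> \<open>Stated for all nonzero points of \<open>K\<close>, since it is applied at a shifted base point.\<close>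
  have no_root: "poly (map_poly complex_of_real p) z \<noteq> 0"
    if x: "x \<in> K - {0}" and v: "v \<in> K - {0}"
      and p: "\<And>t. poly p t = f (x + t *\<^sub>R v)" and deg: "degree p \<le> d" and "Re z = 0"
    for x v p z
  proof (rule no_imaginary_root)
    define g where "g k = iter_deriv (replicate k v) f" for k
    have g: "g k x = fact k * coeff p k" for k
      unfolding g_def by (rule coeff_restrict_line[OF poly p])
    have pos: "coeff p k > 0" if "k \<le> d" for k
    proof -
      have "g k x > 0"
        using clc x v that
        by (auto simp: strictly_CLC_def g_def strictly_log_concave_at_def
            split: if_splits dest!: spec[of _ "replicate k v"])
      then show ?thesis by (simp add: g zero_less_mult_iff)
    qed
    have zero: "coeff p k = 0" if "k > d" for k
      using that deg by (simp add: coeff_eq_0)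
    show "degree p \<le> 4" "coeff p 0 > 0" "coeff p 1 > 0"
      using deg assms pos by auto
    show "coeff p k \<ge> 0" for k
      using pos[of k] zero[of k] by (cases "k \<le> d") auto
    show "real (k + 2) * (coeff p k * coeff p (k + 2)) \<le> real (k + 1) * (coeff p (k + 1))\<^sup>2" for k
    proof (cases "k + 2 \<le> d")
      case True
      have "strictly_log_concave_at (g k) x"
        using clc x v True
        by (auto simp: strictly_CLC_def g_def
            split: if_splits dest!: spec[of _ "replicate k v"])
      moreover have "real_polynomial_function (g k)"
        unfolding g_def using poly by (rule iter_deriv_polynomial_function)
      ultimately have "g k x * dir_deriv v (dir_deriv v (g k)) x < (dir_deriv v (g k) x)\<^sup>2"
        using v by (intro strictly_log_concave_along) auto
      then have "g k x * g (k + 2) x < (g (k + 1) x)\<^sup>2"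
        by (simp add: g_def iter_deriv_def)
      then have "(fact k)\<^sup>2 * (real (k + 1) * (real (k + 2) * (coeff p k * coeff p (k + 2))))
          < (fact k)\<^sup>2 * (real (k + 1) * (real (k + 1) * (coeff p (k + 1))\<^sup>2))"
        by (simp add: g power2_eq_square algebra_simps)
      then show ?thesis by (simp add: mult_less_cancel_left)
    qed (simp add: zero)
  qed (fact \<open>Re z = 0\<close>)
  show ?thesis
    unfolding hurwitz_stable_over_def
  proof (intro disjI2 ballI)
    fix x v assume "x \<in> interior K" "v \<in> interior K"
    then have x: "x \<in> K - {0}" and v: "v \<in> K - {0}"
      using int by auto
    obtain p where p: "\<And>t. poly p t = f (x + t *\<^sub>R v)" "degree p \<le> d"
      using homogeneous_restrict_line[OF hom] by blast
    have "Re z < 0" if root: "poly (map_poly complex_of_real p) z = 0" for z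
    proof (rule ccontr)
      assume "\<not> Re z < 0"
      then have r: "Re z \<ge> 0" by simp
      \<comment> \<open>The restriction of \<open>f\<close> to the same line, based at \<open>x + Re z v\<close>; it has the root
        \<open>i Im z\<close>.\<close>
      define q where "q = p \<circ>\<^sub>p [:Re z, 1:]"
      have rv: "Re z *\<^sub>R v \<in> K"
        using cone(2) v r by (simp add: cone_def)
      then have "x + Re z *\<^sub>R v \<in> K"
        using cone x convex_cone[of K] by blast
      moreover have "x + Re z *\<^sub>R v \<noteq> 0"
      proof
        assume "x + Re z *\<^sub>R v = 0"
        then have "x = - (Re z *\<^sub>R v)" by (simp add: eq_neg_iff_add_eq_0)
        then have "x \<in> K \<inter> uminus ` K"
          using x rv by blast
        then show False using cone(3) x by auto
      qed
      ultimately have "poly (map_poly complex_of_real q) (\<i> * of_real (Im z)) \<noteq> 0"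
        using v p by (intro no_root[of "x + Re z *\<^sub>R v" v])
          (auto simp: q_def poly_pcompose degree_pcompose algebra_simps)
      then show False
        using root complex_eq[of z] by (simp add: q_def poly_of_real_shift)
    qed
    then show "\<exists>p. (\<forall>t. poly p t = f (x + t *\<^sub>R v)) \<and> hurwitz_stable p"
      using p unfolding hurwitz_stable_def by blast
  qed
qed

end
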